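(* Let $p\ge 3$ be an odd natural number, let $K$ be a field of characteristic $0$ with algebraic closure $\overline K$, and let $d,R\in K\smallsetminus\{0\}$ be such that $\sqrt R\notin K$ and the polynomial $g=(Z^p-d)^2-R$ is irreducible in $K[Z]$. Let $y\in\overline K$ be a zero of $h=Z^p-d-\sqrt R$ and $y'\in\overline K$ a zero of $h'=Z^p-d+\sqrt R$. Put $D=d^2-R$, $z=yy'$ and $u=z^{(p-1)/2}(y+y')$. In particular, in this setting $\sqrt R\notin K$, $y,y'$ are irrationals of degree $2p$, and $u$ is a zero of the polynomial $f\in K[Z]$ defined in the context. Then $$\{y,y'\}=\left\{z^{(p+1)/2}\left(\frac{u}{2D}\pm A(u)\sqrt R\right)\right\},$$ where $A\in K[Z]$ is the polynomial defined in the context, and the right-hand side is the set of the two elements obtained from the two choices of sign.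
   Context: An irrational is an element of $\overline K\smallsetminus K$; its degree is the degree of its minimal polynomial over $K$. $\sqrt R\in\overline K$ denotes a fixed choice of one of the two square roots of $R$. Under the assumptions, $D=d^2-R\neq 0$, and $z^p=D$. The polynomial $f\in K[Z]$ (of degree $p$ with leading coefficient $1$) is $$f=D^{(p-1)/2}\sum_{k=0}^{(p-1)/2}\frac{c_{2k+1}}{D^k}Z^{2k+1}-2dD^{(p-1)/2},\qquad c_{2k+1}=(-1)^{(p-1)/2-k}\,\frac{p}{\frac{p+1}{2}+k}\binom{\frac{p+1}{2}+k}{2k+1},$$ for $k=0,\ldots,(p-1)/2$. The polynomial $A\in K[Z]$ is $$A=\frac1{2R}\sum_{k=0}^{(p-1)/2}\frac{a_{2k}}{D^k}Z^{2k}+(-1)^{(p+1)/2}\frac{d}{2RD}Z,\qquad a_{2k}=(-1)^k\,\frac{p-1}{\frac{p-1}{2}+k}\binom{\frac{p-1}{2}+k}{2k},$$ for $k=0,\ldots,(p-1)/2$. Here $\binom{m}{n}$ is the usual binomial coefficient. That $u$ is a zero of $f$ is a fact about the setting that is recalled in the statement, not part of its conclusion. *)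

theory Defs
  imports "HOL-Algebra.Algebraic_Closure_Type"
begin

definition A_coeff :: "nat \<Rightarrow> nat \<Rightarrow> 'a :: field_char_0" where
  "A_coeff p k =
     (-1) ^ k * (of_nat (p - 1) / of_nat ((p - 1) div 2 + k))
       * of_nat (((p - 1) div 2 + k) choose (2 * k))"

definition A_poly :: "nat \<Rightarrow> 'a :: field_char_0 \<Rightarrow> 'a \<Rightarrow> 'a poly" where
  "A_poly p d R = (let D = d ^ 2 - R in
     smult (1 / (2 * R)) (\<Sum>k = 0..(p - 1) div 2. monom (A_coeff p k / D ^ k) (2 * k))
     + monom ((-1) ^ ((p + 1) div 2) * (d / (2 * R * D))) 1)"

end

theory Submission
  imports Defs
begin

text \<open>
  Write \<open>p = 2 m + 1\<close>. Since \<open>z\<^sup>p = (d + \<surd>R) (d - \<surd>R) = D\<close>, we have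
  \<open>z\<^bsup>m+1\<^esup> u / (2 D) = (y + y') / 2\<close> and \<open>u\<^sup>2 / D = (y + y')\<^sup>2 / z\<close>. The coefficients \<open>a\<^sub>2\<^sub>k\<close> are
  those of a Chebyshev polynomial, so Waring's formula for power sums turns the even part of
  \<open>2 R A(u)\<close> into \<open>(-1)\<^sup>m (y\<^bsup>2m\<^esup> + y'\<^bsup>2m\<^esup>) / z\<^sup>m\<close>. With \<open>2 d = y\<^sup>p + y'\<^sup>p\<close> and
  \<open>2 \<surd>R = y\<^sup>p - y'\<^sup>p\<close> this simplifies to \<open>z\<^bsup>m+1\<^esup> A(u) \<surd>R = (-1)\<^sup>m (y' - y) / 2\<close>.
\<close>

text \<open>
  For \<open>x = (a + b)\<^sup>2\<close> and \<open>q = - (a * b)\<close> these sums are the quotients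
  \<open>(a\<^bsup>2m+1\<^esup> - b\<^bsup>2m+1\<^esup>) / (a - b)\<close> and \<open>(a\<^bsup>2m+2\<^esup> - b\<^bsup>2m+2\<^esup>) / (a\<^sup>2 - b\<^sup>2)\<close>, respectively.
\<close>

definition even_binomial_sum :: "nat \<Rightarrow> 'a :: comm_ring_1 \<Rightarrow> 'a \<Rightarrow> 'a" where
  "even_binomial_sum m x q = (\<Sum>k\<le>m. of_nat ((m + k) choose (2 * k)) * x ^ k * q ^ (m - k))"

definition odd_binomial_sum :: "nat \<Rightarrow> 'a :: comm_ring_1 \<Rightarrow> 'a \<Rightarrow> 'a" where
  "odd_binomial_sum m x q = (\<Sum>k\<le>m. of_nat ((m + k + 1) choose (2 * k + 1)) * x ^ k * q ^ (m - k))"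

lemma binomial_sums_0 [simp]: "even_binomial_sum 0 x q = 1" "odd_binomial_sum 0 x q = 1"
  by (simp_all add: even_binomial_sum_def odd_binomial_sum_def)

text \<open>The extra term \<open>k = Suc m\<close> vanishes because
  \<open>2 * m + 1 < 2 * m + 2\<close>. With the longer range, sums for \<open>m\<close> and
  \<open>Suc m\<close> can be compared term by term.\<close>

lemma mult_even_binomial_sum:
  "q * even_binomial_sum m x q =
    (\<Sum>k\<le>Suc m. of_nat ((m + k) choose (2 * k)) * x ^ k * q ^ (Suc m - k))"
  by (simp add: even_binomial_sum_def sum_distrib_left Suc_diff_le binomial_eq_0 mult_ac)

lemma mult_odd_binomial_sum:
  "q * odd_binomial_sum m x q =
    (\<Sum>k\<le>Suc m. of_nat ((m + k + 1) choose (2 * k + 1)) * x ^ k * q ^ (Suc m - k))"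
  by (simp add: odd_binomial_sum_def sum_distrib_left Suc_diff_le binomial_eq_0 mult_ac)

text \<open>Pascal's rule at each \<open>x ^ Suc k\<close>; the constant term
  \<open>q ^ Suc m\<close> comes from the second summand alone.\<close>

lemma even_binomial_sum_Suc:
  "even_binomial_sum (Suc m) x q = x * odd_binomial_sum m x q + q * even_binomial_sum m x q"
proof -
  have "even_binomial_sum (Suc m) x q =
      q ^ Suc m + (\<Sum>k\<le>m. of_nat ((Suc m + Suc k) choose (2 * Suc k)) * x ^ Suc k * q ^ (m - k))"
    by (simp add: even_binomial_sum_def sum.atMost_Suc_shift del: sum.atMost_Suc)
  moreover have "q * even_binomial_sum m x q =
      q ^ Suc m + (\<Sum>k\<le>m. of_nat ((m + Suc k) choose (2 * Suc k)) * x ^ Suc k * q ^ (m - k))"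
    unfolding mult_even_binomial_sum by (simp add: sum.atMost_Suc_shift del: sum.atMost_Suc)
  moreover have "x * odd_binomial_sum m x q =
      (\<Sum>k\<le>m. of_nat ((m + Suc k) choose (2 * k + 1)) * x ^ Suc k * q ^ (m - k))"
    by (simp add: odd_binomial_sum_def sum_distrib_left mult_ac)
  ultimately show ?thesis
    by (simp add: sum.distrib [symmetric] algebra_simps)
qed

lemma odd_binomial_sum_Suc:
  "odd_binomial_sum (Suc m) x q = even_binomial_sum (Suc m) x q + q * odd_binomial_sum m x q"
  unfolding mult_odd_binomial_sum
  by (simp add: odd_binomial_sum_def even_binomial_sum_def sum.distrib [symmetric] algebra_simps
      del: sum.atMost_Suc)

text \<open>The power sums \<open>P n = a ^ n + b ^ n\<close> satisfy
  \<open>P (n + 2) = (a + b) * P (n + 1) - a * b * P n\<close>. This links even and odd indices, so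
  both claims go through one induction.\<close>

lemma power_sum_binomial_sums:
  fixes a b :: "'a :: comm_ring_1"
  defines "x \<equiv> (a + b) ^ 2" and "q \<equiv> - (a * b)"
  shows "even_binomial_sum (Suc m) x q + q * even_binomial_sum m x q
           = a ^ (2 * m + 2) + b ^ (2 * m + 2)"
    and "(a + b) * (odd_binomial_sum (Suc m) x q + q * odd_binomial_sum m x q)
           = a ^ (2 * m + 3) + b ^ (2 * m + 3)"
proof (induction m)
  case 0
  case 1
  show ?case
    by (simp add: even_binomial_sum_Suc x_def q_def power2_eq_square algebra_simps)
  case 2
  show ?case
    by (simp add: odd_binomial_sum_Suc even_binomial_sum_Suc x_def q_def
        power2_eq_square power3_eq_cube algebra_simps)
next
  case (Suc m)
  let ?S = "\<lambda>n. even_binomial_sum n x q" and ?T = "\<lambda>n. odd_binomial_sum n x q"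
  have "?S (Suc (Suc m)) + q * ?S (Suc m) =
      (a + b) * ((a + b) * (?T (Suc m) + q * ?T m)) + q * (?S (Suc m) + q * ?S m)"
    unfolding even_binomial_sum_Suc [of "Suc m"] even_binomial_sum_Suc [of m]
    by (simp add: x_def power2_eq_square algebra_simps)
  also have "\<dots> = a ^ (2 * Suc m + 2) + b ^ (2 * Suc m + 2)"
    unfolding Suc.IH by (simp add: q_def power_add numeral_eq_Suc algebra_simps)
  finally show S: "?S (Suc (Suc m)) + q * ?S (Suc m) = a ^ (2 * Suc m + 2) + b ^ (2 * Suc m + 2)" .
  have "(a + b) * (?T (Suc (Suc m)) + q * ?T (Suc m)) =
      (a + b) * (?S (Suc (Suc m)) + q * ?S (Suc m)) + q * ((a + b) * (?T (Suc m) + q * ?T m))"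
    unfolding odd_binomial_sum_Suc [of "Suc m"] odd_binomial_sum_Suc [of m]
    by (simp add: algebra_simps)
  also have "\<dots> = a ^ (2 * Suc m + 3) + b ^ (2 * Suc m + 3)"
    unfolding S Suc.IH by (simp add: q_def power_add numeral_eq_Suc algebra_simps)
  finally show "(a + b) * (?T (Suc (Suc m)) + q * ?T (Suc m)) = \<dots>" .
qed

text \<open>Absorption, \<open>(n - 2 * k) * (n choose (2 * k)) = n * ((n - 1) choose (2 *
  k))\<close>, removes the quotient, since \<open>2 * Suc m = n + (n - 2 * k)\<close> for
  \<open>n = Suc m + k\<close>; the bound on \<open>k\<close> keeps the subtraction exact.\<close>

lemma A_coeff_Suc:
  assumes "k \<le> Suc m"
  shows "(A_coeff (2 * Suc m + 1) k :: 'a :: field_char_0) =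
    (-1) ^ k * (of_nat ((Suc m + k) choose (2 * k)) + of_nat ((m + k) choose (2 * k)))"
proof -
  define n where "n = Suc m + k"
  have "(2 * Suc m) * (n choose (2 * k)) = (n + (n - 2 * k)) * (n choose (2 * k))"
    using assms by (simp add: n_def)
  also have "\<dots> = n * ((n choose (2 * k)) + ((n - 1) choose (2 * k)))"
    by (simp only: add_mult_distrib binomial_absorb_comp add_mult_distrib2)
  finally have "of_nat (2 * Suc m) * of_nat (n choose (2 * k)) =
      (of_nat n * (of_nat (n choose (2 * k)) + of_nat ((n - 1) choose (2 * k))) :: 'a)"
    by (metis of_nat_add of_nat_mult)
  moreover have "(of_nat n :: 'a) \<noteq> 0"
    unfolding of_nat_eq_0_iff by (simp add: n_def)
  ultimately have "of_nat (2 * Suc m) / of_nat n * of_nat (n choose (2 * k)) =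
      (of_nat (n choose (2 * k)) + of_nat ((n - 1) choose (2 * k)) :: 'a)"
    by (simp add: divide_simps mult.commute)
  moreover have "(2 * Suc m + 1 - 1) div 2 + k = n" "2 * Suc m + 1 - 1 = 2 * Suc m" "m + k = n - 1"
    by (simp_all add: n_def)
  ultimately show ?thesis
    unfolding A_coeff_def n_def [symmetric] by (simp only: mult.assoc)
qed

text \<open>Multiplying by \<open>q ^ m\<close> homogenizes the sum, which then splits into two even
  binomial sums. For \<open>m = 0\<close> the coefficient would be 0/0, that is 0, while the
  right-hand side is 2.\<close>

lemma sum_A_coeff:
  fixes a b :: "'a :: field_char_0"
  assumes "m > 0" "a \<noteq> 0" "b \<noteq> 0"
  shows "(\<Sum>k\<le>m. A_coeff (2 * m + 1) k * ((a + b) ^ 2 / (a * b)) ^ k) =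
    (-1) ^ m * (a ^ (2 * m) + b ^ (2 * m)) / (a * b) ^ m"
proof -
  obtain n where m: "m = Suc n"
    using assms(1) gr0_implies_Suc by blast
  define x q where "x = (a + b) ^ 2" and "q = - (a * b)"
  have q: "q \<noteq> 0"
    using assms by (simp add: q_def)
  have "A_coeff (2 * m + 1) k * ((a + b) ^ 2 / (a * b)) ^ k * q ^ m =
      of_nat ((Suc n + k) choose (2 * k)) * x ^ k * q ^ (Suc n - k)
      + of_nat ((n + k) choose (2 * k)) * x ^ k * q ^ (Suc n - k)" if "k \<le> m" for k
  proof -
    \<comment> \<open>The sign of \<open>q\<close> is chosen so that this minus cancels the factor
      \<open>(-1) ^ k\<close> of the coefficient.\<close>
    have "(a + b) ^ 2 / (a * b) = - (x / q)"
      by (simp add: x_def q_def)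
    hence "((a + b) ^ 2 / (a * b)) ^ k = (-1) ^ k * x ^ k / q ^ k"
      by (simp add: power_minus [of "x / q"] power_divide)
    moreover have "q ^ m = q ^ k * q ^ (Suc n - k)"
      using that m by (simp flip: power_add)
    ultimately have "A_coeff (2 * m + 1) k * ((a + b) ^ 2 / (a * b)) ^ k * q ^ m =
        ((-1) ^ k * (-1) ^ k) * (of_nat ((Suc n + k) choose (2 * k)) + of_nat ((n + k) choose (2 * k)))
          * x ^ k * q ^ (Suc n - k)"
      using q unfolding m A_coeff_Suc [OF that [unfolded m]] by simp
    also have "(-1) ^ k * (-1) ^ k = (1 :: 'a)"
      by (simp flip: power_mult_distrib)
    finally show ?thesis
      by (simp add: algebra_simps)
  qed
  hence "(\<Sum>k\<le>m. A_coeff (2 * m + 1) k * ((a + b) ^ 2 / (a * b)) ^ k) * q ^ m =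
      even_binomial_sum (Suc n) x q + q * even_binomial_sum n x q"
    unfolding mult_even_binomial_sum
    by (simp add: even_binomial_sum_def sum_distrib_right sum.distrib [symmetric] m
        del: sum.atMost_Suc)
  also have "\<dots> = a ^ (2 * m) + b ^ (2 * m)"
    using power_sum_binomial_sums(1) [of n a b] by (simp add: x_def q_def m)
  finally have "(\<Sum>k\<le>m. A_coeff (2 * m + 1) k * ((a + b) ^ 2 / (a * b)) ^ k) =
      (a ^ (2 * m) + b ^ (2 * m)) / q ^ m"
    using q by (simp add: field_simps)
  also have "q ^ m = (-1) ^ m * (a * b) ^ m"
    by (simp add: q_def power_minus [of "a * b"])
  finally show ?thesis
    by (cases "even m") (simp_all add: add_divide_distrib diff_divide_distrib)
qed

lemma to_ac_A_coeff: "to_ac (A_coeff p k) = A_coeff p k"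
  by (simp add: A_coeff_def)

text \<open>As \<open>to_ac\<close> is a field homomorphism, the whole computation can take place in
  the closure, where \<open>R\<close> is a square.\<close>

lemma map_poly_A_poly: "map_poly to_ac (A_poly p d R) = A_poly p (to_ac d) (to_ac R)"
  by (rule poly_eqI)
    (simp add: A_poly_def Let_def coeff_map_poly coeff_sum to_ac_sum to_ac_A_coeff
      if_distrib [of to_ac] cong: if_cong)

lemma poly_A_poly:
  "poly (A_poly p d R) x =
    ((\<Sum>k\<le>(p - 1) div 2. A_coeff p k * (x ^ 2 / (d ^ 2 - R)) ^ k)
      + (-1) ^ ((p + 1) div 2) * d * x / (d ^ 2 - R)) / (2 * R)"
  by (simp add: A_poly_def Let_def poly_sum poly_monom power_divide power_mult
      atMost_atLeast0 add_divide_distrib)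

lemma conjugate_root_identities:
  fixes y y' d s :: "'a :: field_char_0"
  assumes "m > 0" "s \<noteq> 0" "y \<noteq> 0" "y' \<noteq> 0"
    and y: "y ^ (2 * m + 1) = d + s" and y': "y' ^ (2 * m + 1) = d - s"
  defines "D \<equiv> d ^ 2 - s ^ 2" and "z \<equiv> y * y'"
  defines "u \<equiv> z ^ m * (y + y')"
  shows "z ^ (m + 1) * (u / (2 * D)) = (y + y') / 2"
    and "z ^ (m + 1) * (poly (A_poly (2 * m + 1) d (s ^ 2)) u * s) = (-1) ^ m * (y' - y) / 2"
proof -
  \<comment> \<open>\<open>D\<close> is the full power \<open>z ^ (2 * m + 1)\<close>, split below
    to match the factor \<open>z ^ m\<close> of \<open>u\<close> and the prefactor
    \<open>z ^ (m + 1)\<close>.\<close>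
  have z: "z \<noteq> 0"
    using assms by simp
  have D: "D = z ^ m * z ^ (m + 1)"
  proof -
    have "D = y ^ (2 * m + 1) * y' ^ (2 * m + 1)"
      unfolding y y' D_def by (simp add: algebra_simps power2_eq_square)
    thus ?thesis
      by (simp add: z_def mult_2 power_mult_distrib power_add)
  qed
  have uD: "u / D = (y + y') / z ^ (m + 1)"
    unfolding D u_def using z by (simp add: field_simps)
  show "z ^ (m + 1) * (u / (2 * D)) = (y + y') / 2"
    using uD z by (simp add: field_simps)
  have "u ^ 2 / D = (y + y') ^ 2 / (y * y')"
    unfolding D u_def using z by (simp add: field_simps power2_eq_square z_def)
  hence "(\<Sum>k\<le>m. A_coeff (2 * m + 1) k * (u ^ 2 / D) ^ k) =
      (-1) ^ m * (y ^ (2 * m) + y' ^ (2 * m)) / z ^ m"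
    using sum_A_coeff [OF assms(1,3,4)] by (simp only: z_def)
  moreover have "(2 * m + 1 - 1) div 2 = m" "(2 * m + 1 + 1) div 2 = m + 1"
    by simp_all
  ultimately have "poly (A_poly (2 * m + 1) d (s ^ 2)) u * (2 * s ^ 2) =
      (-1) ^ m * (y ^ (2 * m) + y' ^ (2 * m)) / z ^ m
      + (-1) ^ (m + 1) * d * ((y + y') / z ^ (m + 1))"
    using assms(2) by (simp only: poly_A_poly D_def [symmetric] uD [symmetric]) simp
  hence "z ^ (m + 1) * (poly (A_poly (2 * m + 1) d (s ^ 2)) u * (2 * s ^ 2)) =
      z ^ (m + 1) * ((-1) ^ m * (y ^ (2 * m) + y' ^ (2 * m)) / z ^ m
      + (-1) ^ (m + 1) * d * ((y + y') / z ^ (m + 1)))"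
    by (simp only:)
  also have "\<dots> = (-1) ^ m * (z * (y ^ (2 * m) + y' ^ (2 * m)) - d * (y + y'))"
    using z by (simp add: field_simps)
  \<comment> \<open>Regrouping produces \<open>p\<close>-th powers, so the root equations apply; the
    terms in \<open>d\<close> then cancel and a factor \<open>s\<close> remains.\<close>
  also have "z * (y ^ (2 * m) + y' ^ (2 * m)) = y' * y ^ (2 * m + 1) + y * y' ^ (2 * m + 1)"
    by (simp add: z_def algebra_simps)
  also have "\<dots> - d * (y + y') = s * (y' - y)"
    unfolding y y' by (simp add: algebra_simps)
  finally have "s * (2 * (z ^ (m + 1) * (poly (A_poly (2 * m + 1) d (s ^ 2)) u * s))) =
      s * ((-1) ^ m * (y' - y))"
    by (simp add: power2_eq_square mult_ac)
  thus "z ^ (m + 1) * (poly (A_poly (2 * m + 1) d (s ^ 2)) u * s) = (-1) ^ m * (y' - y) / 2"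
    unfolding mult_left_cancel [OF assms(2)] by (simp only: eq_divide_eq_numeral1) (simp add: mult.commute)
qed

theorem theorem1:
  fixes p :: nat
    and d R D :: "'a :: field_char_0"
    and sqrtR y y' z u :: "'a alg_closure"
  assumes "p \<ge> 3" and "odd p"
    and "d \<noteq> 0" and "R \<noteq> 0"
    and "sqrtR ^ 2 = to_ac R"
    and "sqrtR \<notin> range to_ac"
    and "irreducible ((monom 1 p - [:d:]) ^ 2 - [:R:])"
    and "poly (monom 1 p - [:to_ac d:] - [:sqrtR:]) y = 0"
    and "poly (monom 1 p - [:to_ac d:] + [:sqrtR:]) y' = 0"
    and "D = d ^ 2 - R"
    and "z = y * y'"
    and "u = z ^ ((p - 1) div 2) * (y + y')"
  shows "{y, y'} =
    {z ^ ((p + 1) div 2) * (u / to_ac (2 * D) + poly (map_poly to_ac (A_poly p d R)) u * sqrtR),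
     z ^ ((p + 1) div 2) * (u / to_ac (2 * D) - poly (map_poly to_ac (A_poly p d R)) u * sqrtR)}"
proof -
  obtain m where p: "p = 2 * m + 1"
    using assms(2) oddE by blast
  have m: "m > 0" and m1: "(p - 1) div 2 = m" "(p + 1) div 2 = m + 1"
    using assms(1) p by auto
  have u: "u = z ^ m * (y + y')"
    using assms(12) by (simp only: m1)
  have y: "y ^ (2 * m + 1) = to_ac d + sqrtR" and y': "y' ^ (2 * m + 1) = to_ac d - sqrtR"
    using assms(8,9) by (simp_all add: p poly_monom algebra_simps)
  have "sqrtR \<noteq> 0"
    using assms(4,5) by auto
  \<comment> \<open>Both \<open>to_ac d\<close> and its negative lie in the base field, so neither
    \<open>p\<close>-th power vanishes.\<close>
  have "sqrtR \<noteq> - to_ac d" "sqrtR \<noteq> to_ac d"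
    using assms(6) by (metis rangeI to_ac_minus)+
  hence "y \<noteq> 0" "y' \<noteq> 0"
    using y y' by (auto simp: add_eq_0_iff)
  note * = conjugate_root_identities [OF m \<open>sqrtR \<noteq> 0\<close> this y y', folded assms(11), folded u]
  define v w where "v = z ^ (m + 1) * (u / to_ac (2 * D))"
    and "w = z ^ (m + 1) * (poly (map_poly to_ac (A_poly p d R)) u * sqrtR)"
  have v: "v = (y + y') / 2"
    using *(1) by (simp add: v_def assms(5,10))
  have w: "w = (-1) ^ m * (y' - y) / 2"
    using *(2) by (simp add: w_def map_poly_A_poly assms(5) p)
  \<comment> \<open>The parity of \<open>m\<close> only decides which sign gives which root; the
    unordered pair is the same.\<close>
  have "v + w = (if even m then y' else y)" "v - w = (if even m then y else y')"
    unfolding v w by (simp_all add: field_simps)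
  hence "{y, y'} = {v + w, v - w}"
    by auto
  thus ?thesis
    by (simp only: m1 v_def w_def distrib_left right_diff_distrib)
qed

end
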